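(* Let $(G,\sigma)$ be a connected connection graph, with $\sigma$ taking values in $\mathbb{O}(d)$, and let $\alpha,\beta\in\ell(V;\mathbb{R}^d)$. Then the optimal parallel transportation problem $$\mathcal{W}_1^\sigma(\alpha,\beta)=\inf_{J\in\ell(E';\mathbb{R}^d)}\left\{\sum_{e\in E'}w(e)\|J(e)\|_2 : BJ=\alpha-\beta\right\}$$ is feasible and $\mathcal{W}_1^\sigma(\alpha,\beta)<\infty$ if and only if $(\alpha-\beta)\perp\ker(L)$, where $L$ is the connection Laplacian of $(G,\sigma)$.
   Context: $G=(V,E,w)$ is a finite, connected, weighted, undirected graph with $V=\{1,\dots,n\}$, $n\ge 2$, $E\subseteq\binom{V}{2}$, $|E|=m\ge1$, and symmetric weights $w_{ij}\ge 0$ with $w_{ij}>0$ iff $\{i,j\}\in E$ (written $i\sim j$). The index-oriented edge set is $E'=\{(i,j): i<j,\ i\sim j\}$, and $w(e)=w_{ij}$ for $e=(i,j)\in E'$. $\mathbb{O}(d)$ is the group of $d\times d$ real orthogonal matrices, $d\ge1$. A connection is a map $\sigma:E'\to\mathbb{O}(d)$, written $\sigma_{ij}=\sigma((i,j))$, extended by $\sigma_{ji}=\sigma_{ij}^{-1}=\sigma_{ij}^\top$; the pair $(G,\sigma)$ is a connection graph. $\ell(V;\mathbb{R}^d)$ and $\ell(E';\mathbb{R}^d)$ are the spaces of functions $V\to\mathbb{R}^d$ and $E'\to\mathbb{R}^d$, identified with column vectors in $\mathbb{R}^{nd}$ and $\mathbb{R}^{md}$, with the standard inner product $\langle f,g\rangle=f^\top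 g$. The connection incidence matrix $B\in\mathbb{R}^{nd\times md}$ is the block matrix with $d\times d$ blocks, for $i\in V$, $e\in E'$: $B_{ie}=I_d$ if $e=(i,\cdot)$, $B_{ie}=-\sigma_e^\top$ if $e=(\cdot,i)$, and $B_{ie}=0$ otherwise. With $W=\operatorname{diag}(w_{e_1}I_d,\dots,w_{e_m}I_d)\in\mathbb{R}^{md\times md}$ the block diagonal matrix of edge weights, the connection Laplacian is $L=BWB^\top\in\mathbb{R}^{nd\times nd}$. The problem is feasible if some $J\in\ell(E';\mathbb{R}^d)$ satisfies $BJ=\alpha-\beta$; the infimum over the empty set is $+\infty$. *)

theory Defs
  imports "HOL-Analysis.Analysis" "HOL-Library.FuncSet"
begin

text \<open>The vertex set is \<open>{1..n}\<close> and the dimension \<open>d\<close> of the fibres is the cardinality of the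
  finite index type \<open>'d\<close>. Vectors and matrices over \<open>V\<close> and \<open>E'\<close> are kept in block form: a vector
  in \<open>\<real>^(nd)\<close> is a function from \<open>{1..n}\<close> to \<open>real ^ 'd\<close>, and a matrix in \<open>\<real>^(nd \<times> md)\<close> is a
  family of \<open>d \<times> d\<close> blocks indexed by vertices and oriented edges. Blocks whose indices lie outside
  the stated index sets are never used.\<close>

locale connected_weighted_graph =
  fixes n :: nat and E :: "nat set set" and w :: "nat \<Rightarrow> nat \<Rightarrow> real"
  assumes two_vertices: "2 \<le> n"
    and edges: "E \<subseteq> {e. e \<subseteq> {1..n} \<and> card e = 2}"
    and edges_nonempty: "1 \<le> card E"
    and weight_sym: "\<And>i j. i \<in> {1..n} \<Longrightarrow> j \<in> {1..n} \<Longrightarrow> w i j = w j i"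
    and weight_nonneg: "\<And>i j. i \<in> {1..n} \<Longrightarrow> j \<in> {1..n} \<Longrightarrow> 0 \<le> w i j"
    and weight_pos_iff: "\<And>i j. i \<in> {1..n} \<Longrightarrow> j \<in> {1..n} \<Longrightarrow> 0 < w i j \<longleftrightarrow> {i, j} \<in> E"
    and connected: "\<And>i j. i \<in> {1..n} \<Longrightarrow> j \<in> {1..n} \<Longrightarrow> (i, j) \<in> {(k, l). {k, l} \<in> E}\<^sup>*"

definition oriented_edges :: "nat set set \<Rightarrow> (nat \<times> nat) set" where
  "oriented_edges E = {(i, j). i < j \<and> {i, j} \<in> E}"

locale connected_connection_graph = connected_weighted_graph n E w
  for n :: nat and E :: "nat set set" and w :: "nat \<Rightarrow> nat \<Rightarrow> real" +
  fixes \<sigma> :: "nat \<times> nat \<Rightarrow> real ^ 'd ^ 'd"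
  assumes connection_orthogonal: "\<And>e. e \<in> oriented_edges E \<Longrightarrow> orthogonal_matrix (\<sigma> e)"

definition fun_space :: "'i set \<Rightarrow> ('i \<Rightarrow> real ^ 'd) set" where
  "fun_space S = S \<rightarrow>\<^sub>E UNIV"

definition fun_inner :: "'i set \<Rightarrow> ('i \<Rightarrow> real ^ 'd) \<Rightarrow> ('i \<Rightarrow> real ^ 'd) \<Rightarrow> real" where
  "fun_inner S f g = (\<Sum>i\<in>S. f i \<bullet> g i)"

definition fun_diff :: "'i set \<Rightarrow> ('i \<Rightarrow> real ^ 'd) \<Rightarrow> ('i \<Rightarrow> real ^ 'd) \<Rightarrow> 'i \<Rightarrow> real ^ 'd" where
  "fun_diff S f g = (\<lambda>i\<in>S. f i - g i)"

type_synonym ('i, 'j, 'd) block_matrix = "'i \<Rightarrow> 'j \<Rightarrow> real ^ 'd ^ 'd"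

definition block_transpose :: "('i, 'j, 'd::finite) block_matrix \<Rightarrow> ('j, 'i, 'd) block_matrix" where
  "block_transpose A = (\<lambda>j i. transpose (A i j))"

definition block_mult ::
  "'j set \<Rightarrow> ('i, 'j, 'd::finite) block_matrix \<Rightarrow> ('j, 'k, 'd) block_matrix \<Rightarrow> ('i, 'k, 'd) block_matrix"
  where "block_mult S A C = (\<lambda>i k. \<Sum>j\<in>S. A i j ** C j k)"

definition block_apply ::
  "'i set \<Rightarrow> 'j set \<Rightarrow> ('i, 'j, 'd::finite) block_matrix \<Rightarrow> ('j \<Rightarrow> real ^ 'd) \<Rightarrow> 'i \<Rightarrow> real ^ 'd"
  where "block_apply R S A f = (\<lambda>i\<in>R. \<Sum>j\<in>S. A i j *v f j)"

definition block_kernel ::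
  "'i set \<Rightarrow> 'j set \<Rightarrow> ('i, 'j, 'd::finite) block_matrix \<Rightarrow> ('j \<Rightarrow> real ^ 'd) set"
  where "block_kernel R S A = {f \<in> fun_space S. block_apply R S A f = (\<lambda>i\<in>R. 0)}"

definition incidence_matrix ::
  "(nat \<times> nat \<Rightarrow> real ^ 'd ^ 'd) \<Rightarrow> (nat, nat \<times> nat, 'd::finite) block_matrix" where
  "incidence_matrix \<sigma> =
     (\<lambda>i e. if fst e = i then mat 1 else if snd e = i then - transpose (\<sigma> e) else 0)"

definition weight_matrix ::
  "(nat \<Rightarrow> nat \<Rightarrow> real) \<Rightarrow> (nat \<times> nat, nat \<times> nat, 'd::finite) block_matrix" where
  "weight_matrix w = (\<lambda>e e'. if e = e' then mat (w (fst e) (snd e)) else 0)"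

definition connection_laplacian ::
  "nat set set \<Rightarrow> (nat \<Rightarrow> nat \<Rightarrow> real) \<Rightarrow> (nat \<times> nat \<Rightarrow> real ^ 'd ^ 'd) \<Rightarrow> (nat, nat, 'd::finite) block_matrix"
  where
  "connection_laplacian E w \<sigma> =
     block_mult (oriented_edges E)
       (block_mult (oriented_edges E) (incidence_matrix \<sigma>) (weight_matrix w))
       (block_transpose (incidence_matrix \<sigma>))"

definition feasible_flows ::
  "nat \<Rightarrow> nat set set \<Rightarrow> (nat \<times> nat \<Rightarrow> real ^ 'd ^ 'd) \<Rightarrow> (nat \<Rightarrow> real ^ 'd) \<Rightarrow> (nat \<Rightarrow> real ^ 'd)
    \<Rightarrow> (nat \<times> nat \<Rightarrow> real ^ 'd::finite) set" where
  "feasible_flows n E \<sigma> \<alpha> \<beta> =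
     {J \<in> fun_space (oriented_edges E).
        block_apply {1..n} (oriented_edges E) (incidence_matrix \<sigma>) J = fun_diff {1..n} \<alpha> \<beta>}"

text \<open>The value is taken in \<^typ>\<open>ereal\<close>, where the infimum of the empty set is \<open>\<infinity>\<close>.\<close>

definition transport_cost ::
  "nat \<Rightarrow> nat set set \<Rightarrow> (nat \<Rightarrow> nat \<Rightarrow> real) \<Rightarrow> (nat \<times> nat \<Rightarrow> real ^ 'd ^ 'd)
    \<Rightarrow> (nat \<Rightarrow> real ^ 'd) \<Rightarrow> (nat \<Rightarrow> real ^ 'd::finite) \<Rightarrow> ereal" where
  "transport_cost n E w \<sigma> \<alpha> \<beta> =
     (INF J \<in> feasible_flows n E \<sigma> \<alpha> \<beta>.
        ereal (\<Sum>e\<in>oriented_edges E. w (fst e) (snd e) * norm (J e)))"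

end

theory Submission
  imports Defs
begin

text \<open>The flows are the solutions of \<open>B J = \<alpha> - \<beta>\<close>, and a feasible problem has finite
  value, so the claim is that the range of \<open>B\<close> is the orthogonal complement of \<open>ker L\<close>. Positivity
  of the edge weights and \<open>\<langle>f, L f\<rangle> = \<Sum> w(e) |(B\<^sup>T f)(e)|\<^sup>2\<close> give \<open>ker L = ker B\<^sup>T\<close>. If
  \<open>\<alpha> - \<beta>\<close> is orthogonal to this kernel, then so is the residual of a least-squares solution, which
  itself lies in the kernel and hence vanishes.\<close>

lemma fun_inner_self_eq_0:
  assumes "finite S" and "fun_inner S f f = 0" and "i \<in> S"
  shows "f i = 0"
  using assms by (simp add: fun_inner_def sum_nonneg_eq_0_iff)

text \<open>Gram--Schmidt by induction on the generators: \<open>u\<close> is the component of the new generator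
  orthogonal to the old ones.\<close>

lemma least_squares_coefficients:
  fixes a :: "'t \<Rightarrow> 'i \<Rightarrow> real ^ 'd::finite"
  assumes "finite T" and "finite R"
  shows "\<exists>c. \<forall>s\<in>T. fun_inner R (\<lambda>i. b i - (\<Sum>t\<in>T. c t *\<^sub>R a t i)) (a s) = 0"
  using assms(1)
proof (induction T arbitrary: b rule: finite_induct)
  case empty
  show ?case by simp
next
  case (insert v T)
  \<comment> \<open>The induction hypothesis is used for two targets, \<open>b\<close> itself and
    the new generator \<open>a v\<close>; this is why \<open>b\<close> is kept arbitrary.\<close>
  obtain c where c: "\<And>s. s \<in> T \<Longrightarrow> fun_inner R (\<lambda>i. b i - (\<Sum>t\<in>T. c t *\<^sub>R a t i)) (a s) = 0"
    using insert.IH[of b] by blast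
  obtain g where g: "\<And>s. s \<in> T \<Longrightarrow> fun_inner R (\<lambda>i. a v i - (\<Sum>t\<in>T. g t *\<^sub>R a t i)) (a s) = 0"
    using insert.IH[of "a v"] by blast
  define x where "x = (\<lambda>i. b i - (\<Sum>t\<in>T. c t *\<^sub>R a t i))"
  define u where "u = (\<lambda>i. a v i - (\<Sum>t\<in>T. g t *\<^sub>R a t i))"
  define l where "l = fun_inner R x u / fun_inner R u u"
  define y where "y = (\<lambda>i. x i - l *\<^sub>R u i)"
  have y_inner: "fun_inner R y f = fun_inner R x f - l * fun_inner R u f" for f
    by (simp add: y_def fun_inner_def inner_diff_left sum_subtractf sum_distrib_left)
  have y_old: "fun_inner R y (a s) = 0" if "s \<in> T" for s
    using c[OF that] g[OF that] by (simp add: y_inner x_def u_def)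
  \<comment> \<open>In the degenerate case \<open>l\<close> is a quotient by zero, but its value is
    irrelevant: \<open>u\<close> vanishes on \<open>R\<close>, so both terms of
    \<open>y_inner\<close> at \<open>u\<close> are 0.\<close>
  have "fun_inner R x u = 0" if "fun_inner R u u = 0"
    using fun_inner_self_eq_0[OF assms(2) that] by (simp add: fun_inner_def)
  then have y_u: "fun_inner R y u = 0"
    by (cases "fun_inner R u u = 0") (simp_all add: y_inner l_def)
  \<comment> \<open>Since \<open>a v\<close> is \<open>u\<close> plus a combination of the old
    generators, orthogonality of \<open>y\<close> to all of these carries over to
    \<open>a v\<close>.\<close>
  have "fun_inner R y (a v) = fun_inner R y u + (\<Sum>t\<in>T. g t * fun_inner R y (a t))"
  proof -
    have "fun_inner R y u = fun_inner R y (a v) - (\<Sum>i\<in>R. \<Sum>t\<in>T. g t * (y i \<bullet> a t i))"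
      by (simp add: u_def fun_inner_def inner_diff_right inner_sum_right sum_subtractf)
    also have "(\<Sum>i\<in>R. \<Sum>t\<in>T. g t * (y i \<bullet> a t i)) = (\<Sum>t\<in>T. g t * fun_inner R y (a t))"
      by (subst sum.swap) (simp add: fun_inner_def sum_distrib_left)
    finally show ?thesis by simp
  qed
  then have y_v: "fun_inner R y (a v) = 0"
    by (simp add: y_u y_old)
  \<comment> \<open>These are the coefficients obtained by expanding \<open>u\<close> in
    \<open>y = x - l u\<close>: \<open>a v\<close> enters with weight \<open>l\<close>, and each old
    generator is corrected by \<open>- l * g t\<close>.\<close>
  define c' where "c' = (\<lambda>t. if t = v then l else c t - l * g t)"
  have "b i - (\<Sum>t\<in>insert v T. c' t *\<^sub>R a t i) = y i" for i
  proof -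
    have "(\<Sum>t\<in>T. c' t *\<^sub>R a t i) = (\<Sum>t\<in>T. c t *\<^sub>R a t i - l *\<^sub>R (g t *\<^sub>R a t i))"
      using insert.hyps by (intro sum.cong) (auto simp: c'_def scaleR_diff_left)
    then show ?thesis
      using insert.hyps
      by (simp add: y_def x_def u_def c'_def sum_subtractf scaleR_sum_right algebra_simps)
  qed
  then show ?case
    using y_old y_v by (intro exI[of _ c']) auto
qed

lemma block_apply_in_fun_space: "block_apply R S A f \<in> fun_space R"
  by (simp add: block_apply_def fun_space_def)

lemma block_apply_zero:
  assumes "\<And>j. j \<in> S \<Longrightarrow> f j = 0"
  shows "block_apply R S A f = (\<lambda>i\<in>R. 0)"
  using assms by (auto simp: block_apply_def restrict_def fun_eq_iff)

lemma inner_matrix_vector_transpose: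
  fixes M :: "real ^ 'd::finite ^ 'e::finite"
  shows "(M *v x) \<bullet> y = x \<bullet> (transpose M *v y)"
  by (metis dot_lmul_matrix vector_transpose_matrix)

text \<open>Adjointness holds block by block, and swapping the two sums assembles it. It serves both
  for the range of a matrix against the kernel of its transpose and for the quadratic form of the
  Laplacian.\<close>

lemma fun_inner_block_apply:
  fixes A :: "('i, 'j, 'd::finite) block_matrix"
  shows "fun_inner R (block_apply R S A f) g =
    fun_inner S f (block_apply S R (block_transpose A) g)"
proof -
  have "fun_inner R (block_apply R S A f) g = (\<Sum>i\<in>R. \<Sum>j\<in>S. f j \<bullet> (transpose (A i j) *v g i))"
    by (simp add: fun_inner_def block_apply_def inner_sum_left inner_matrix_vector_transpose)
  also have "\<dots> = fun_inner S f (block_apply S R (block_transpose A) g)"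
    by (subst sum.swap) (simp add: fun_inner_def block_apply_def block_transpose_def inner_sum_right)
  finally show ?thesis .
qed

lemma matrix_vector_mult_sum_left: "(\<Sum>j\<in>S. A j) *v x = (\<Sum>j\<in>S. A j *v x)"
  by (induction S rule: infinite_finite_induct) (simp_all add: matrix_vector_mult_add_rdistrib)

lemma matrix_vector_mult_sum_right:
  fixes A :: "real ^ 'd::finite ^ 'e::finite"
  shows "A *v (\<Sum>j\<in>S. x j) = (\<Sum>j\<in>S. A *v x j)"
  by (induction S rule: infinite_finite_induct) (simp_all add: matrix_vector_right_distrib)

text \<open>Allows the Laplacian to act one factor at a time: the transposed incidence matrix, then
  the weights, then the incidence matrix.\<close>

lemma block_apply_block_mult:
  fixes A :: "('i, 'j, 'd::finite) block_matrix"
  shows "block_apply R T (block_mult S A C) f = block_apply R S A (block_apply S T C f)"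
proof
  fix i
  have "(\<Sum>k\<in>T. \<Sum>j\<in>S. A i j *v (C j k *v f k)) = (\<Sum>j\<in>S. \<Sum>k\<in>T. A i j *v (C j k *v f k))"
    by (rule sum.swap)
  then show "block_apply R T (block_mult S A C) f i = block_apply R S A (block_apply S T C f) i"
    by (simp add: block_apply_def block_mult_def matrix_vector_mult_sum_left
        matrix_vector_mult_sum_right matrix_vector_mul_assoc restrict_def)
qed

lemma block_apply_weight_matrix:
  assumes "finite S"
  shows "block_apply S S (weight_matrix w) f = (\<lambda>e\<in>S. w (fst e) (snd e) *\<^sub>R f e)"
proof
  fix e
  have mat: "mat r *v x = r *\<^sub>R x" for r and x :: "real ^ 'a"
    by (simp add: mat_def matrix_vector_mult_def vec_eq_iff if_distrib[of "\<lambda>z. z * _"] cong: if_cong)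
  have "(\<Sum>e'\<in>S. weight_matrix w e e' *v f e') =
      (\<Sum>e'\<in>S. if e = e' then w (fst e) (snd e) *\<^sub>R f e else 0)"
    by (rule sum.cong) (auto simp: weight_matrix_def mat)
  then show "block_apply S S (weight_matrix w) f e = (\<lambda>e\<in>S. w (fst e) (snd e) *\<^sub>R f e) e"
    using assms by (simp add: block_apply_def)
qed

text \<open>These are the normal equations. They say that the residual is orthogonal to every scalar
  column of \<open>A\<close>, so the generators are these columns, indexed by a block index
  \<open>j\<close> and a coordinate \<open>k\<close>.\<close>

lemma least_squares_block:
  fixes A :: "('i, 'j, 'd::finite) block_matrix"
  assumes "finite R" and "finite S"
  shows "\<exists>J\<in>fun_space S.
    block_apply S R (block_transpose A) (fun_diff R b (block_apply R S A J)) = (\<lambda>j\<in>S. 0)"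
proof -
  obtain c where c: "\<And>j k. j \<in> S \<Longrightarrow>
      fun_inner R (\<lambda>i. b i - (\<Sum>t\<in>S \<times> UNIV. c t *\<^sub>R column (snd t) (A i (fst t))))
        (\<lambda>i. column k (A i j)) = 0"
    using least_squares_coefficients[of "S \<times> (UNIV :: 'd set)" R b "\<lambda>t i. column (snd t) (A i (fst t))"]
      assms by auto
  \<comment> \<open>With \<open>c (j, k)\<close> as coordinate \<open>k\<close> of block
    \<open>j\<close>, applying \<open>A\<close> to \<open>J\<close> gives exactly the combination of
    columns with coefficients \<open>c\<close>.\<close>
  define J where "J = (\<lambda>j\<in>S. \<chi> k. c (j, k))"
  have residual: "fun_diff R b (block_apply R S A J) i =
      b i - (\<Sum>t\<in>S \<times> UNIV. c t *\<^sub>R column (snd t) (A i (fst t)))" if "i \<in> R" for i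
  proof -
    have "(\<Sum>j\<in>S. A i j *v J j) = (\<Sum>j\<in>S. \<Sum>k\<in>UNIV. c (j, k) *\<^sub>R column k (A i j))"
      by (simp add: J_def matrix_mult_sum scalar_mult_eq_scaleR)
    then show ?thesis
      using that by (simp add: fun_diff_def block_apply_def sum.cartesian_product split_def)
  qed
  have "block_apply S R (block_transpose A) (fun_diff R b (block_apply R S A J)) j = 0"
    if "j \<in> S" for j
  proof -
    have "(\<Sum>i\<in>R. transpose (A i j) *v fun_diff R b (block_apply R S A J) i) $ k = 0" for k
    proof -
      have "(transpose (A i j) *v z) $ k = z \<bullet> column k (A i j)" for i z
        by (simp add: matrix_vector_mult_def transpose_def column_def inner_vec_def mult.commute)
      then show ?thesis
        using c[OF that, of k] by (simp add: fun_inner_def residual)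
    qed
    then show ?thesis
      using that by (simp add: block_apply_def block_transpose_def vec_eq_iff)
  qed
  then have "block_apply S R (block_transpose A) (fun_diff R b (block_apply R S A J)) = (\<lambda>j\<in>S. 0)"
    by (auto simp: fun_eq_iff block_apply_def)
  then show ?thesis
    by (intro bexI[of _ J]) (auto simp: J_def fun_space_def)
qed

text \<open>The Fredholm alternative in finite dimension. Necessity is adjointness; sufficiency
  shows that a least-squares residual is orthogonal to itself.\<close>

lemma block_system_solvable_iff:
  fixes A :: "('i, 'j, 'd::finite) block_matrix"
  assumes "finite R" and "finite S" and b: "b \<in> fun_space R"
  shows "(\<exists>J\<in>fun_space S. block_apply R S A J = b) \<longleftrightarrow>
    (\<forall>f\<in>block_kernel S R (block_transpose A). fun_inner R b f = 0)"
proof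
  assume "\<exists>J\<in>fun_space S. block_apply R S A J = b"
  then obtain J where J: "block_apply R S A J = b" by blast
  show "\<forall>f\<in>block_kernel S R (block_transpose A). fun_inner R b f = 0"
    unfolding J[symmetric] fun_inner_block_apply by (simp add: block_kernel_def fun_inner_def)
next
  assume orth: "\<forall>f\<in>block_kernel S R (block_transpose A). fun_inner R b f = 0"
  obtain J where J: "J \<in> fun_space S" and
    "block_apply S R (block_transpose A) (fun_diff R b (block_apply R S A J)) = (\<lambda>j\<in>S. 0)"
    using least_squares_block[OF assms(1,2)] by blast
  moreover define r where "r = fun_diff R b (block_apply R S A J)"
  ultimately have kernel: "block_apply S R (block_transpose A) r = (\<lambda>j\<in>S. 0)"
    by simp
  then have "r \<in> block_kernel S R (block_transpose A)"
    by (simp add: block_kernel_def r_def fun_diff_def fun_space_def)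
  \<comment> \<open>The residual \<open>r\<close> is the difference of \<open>b\<close> and the
    image of \<open>J\<close>. The hypothesis makes it orthogonal to the former, adjointness to the
    latter.\<close>
  then have "fun_inner R b r = 0"
    using orth by blast
  moreover have "fun_inner R (block_apply R S A J) r = 0"
    unfolding fun_inner_block_apply kernel by (simp add: fun_inner_def)
  moreover have "fun_inner R r f = fun_inner R b f - fun_inner R (block_apply R S A J) f" for f
    by (simp add: r_def fun_inner_def fun_diff_def inner_diff_left sum_subtractf)
  ultimately have "fun_inner R r r = 0" by simp
  then have "block_apply R S A J i = b i" if "i \<in> R" for i
    using fun_inner_self_eq_0[OF assms(1) _ that, of r] that by (simp add: r_def fun_diff_def)
  \<comment> \<open>Both sides are extensional on \<open>R\<close>, so agreement on \<open>R\<close>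
    is equality of functions.\<close>
  then have "block_apply R S A J = b"
    using b by (intro PiE_ext[of _ R "\<lambda>_. UNIV"])
      (simp_all add: fun_space_def block_apply_in_fun_space[unfolded fun_space_def])
  then show "\<exists>J\<in>fun_space S. block_apply R S A J = b"
    using J by blast
qed

lemma block_kernel_connection_laplacian:
  fixes \<sigma> :: "nat \<times> nat \<Rightarrow> real ^ 'd::finite ^ 'd"
  assumes "finite (oriented_edges E)"
    and pos: "\<And>e. e \<in> oriented_edges E \<Longrightarrow> 0 < w (fst e) (snd e)"
  shows "block_kernel V V (connection_laplacian E w \<sigma>) =
    block_kernel (oriented_edges E) V (block_transpose (incidence_matrix \<sigma>))"
proof -
  let ?S = "oriented_edges E"
  let ?B = "incidence_matrix \<sigma>"
  have eq: "block_apply V V (connection_laplacian E w \<sigma>) f = (\<lambda>i\<in>V. 0) \<longleftrightarrow>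
      block_apply ?S V (block_transpose ?B) f = (\<lambda>e\<in>?S. 0)" for f
  proof -
    define h where "h = block_apply ?S V (block_transpose ?B) f"
    define wh where "wh = (\<lambda>e\<in>?S. w (fst e) (snd e) *\<^sub>R h e)"
    have L: "block_apply V V (connection_laplacian E w \<sigma>) f = block_apply V ?S ?B wh"
      by (simp add: connection_laplacian_def block_apply_block_mult
          block_apply_weight_matrix[OF assms(1)] h_def wh_def)
    have "h = (\<lambda>e\<in>?S. 0)" if "block_apply V ?S ?B wh = (\<lambda>i\<in>V. 0)"
    proof -
      \<comment> \<open>Pairing the equation with \<open>f\<close> and moving the incidence matrix
        across turns it into the weighted sum of the squared norms of \<open>h\<close>; each term is
        nonnegative, so each is 0.\<close>
      have "fun_inner ?S wh h = 0"
        using that fun_inner_block_apply[of V ?S ?B wh f] by (simp add: h_def fun_inner_def)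
      then have "(\<Sum>e\<in>?S. w (fst e) (snd e) * (h e \<bullet> h e)) = 0"
        by (simp add: fun_inner_def wh_def)
      then have "\<forall>e\<in>?S. w (fst e) (snd e) * (h e \<bullet> h e) = 0"
        using assms(1) pos
        by (subst (asm) sum_nonneg_eq_0_iff) (simp_all add: less_imp_le)
      then have "\<forall>e\<in>?S. h e = 0"
        using pos by fastforce
      then show ?thesis
        by (auto simp: fun_eq_iff h_def block_apply_def)
    qed
    moreover have "block_apply V ?S ?B wh = (\<lambda>i\<in>V. 0)" if "h = (\<lambda>e\<in>?S. 0)"
      using that by (intro block_apply_zero) (simp add: wh_def)
    ultimately show ?thesis
      unfolding L h_def[symmetric] by blast
  qed
  show ?thesis
    by (simp add: block_kernel_def eq)
qed

context connected_weighted_graph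
begin

lemma oriented_edge_vertices:
  assumes "e \<in> oriented_edges E"
  shows "fst e \<in> {1..n}" and "snd e \<in> {1..n}"
  using assms edges by (auto simp: oriented_edges_def)

lemma finite_oriented_edges: "finite (oriented_edges E)"
proof (rule finite_subset)
  show "oriented_edges E \<subseteq> {1..n} \<times> {1..n}"
    using oriented_edge_vertices by (metis mem_Times_iff subsetI)
qed simp

lemma oriented_edge_weight_pos: "e \<in> oriented_edges E \<Longrightarrow> 0 < w (fst e) (snd e)"
  using oriented_edge_vertices[of e] weight_pos_iff by (auto simp: oriented_edges_def)

end

theorem proposition2p1:
  fixes n :: nat and E :: "nat set set" and w :: "nat \<Rightarrow> nat \<Rightarrow> real"
    and \<sigma> :: "nat \<times> nat \<Rightarrow> real ^ 'd::finite ^ 'd"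
    and \<alpha> \<beta> :: "nat \<Rightarrow> real ^ 'd"
  assumes "connected_connection_graph n E w \<sigma>"
    and "\<alpha> \<in> fun_space {1..n}" and "\<beta> \<in> fun_space {1..n}"
  shows "(feasible_flows n E \<sigma> \<alpha> \<beta> \<noteq> {} \<and> transport_cost n E w \<sigma> \<alpha> \<beta> < \<infinity>) \<longleftrightarrow>
    (\<forall>f \<in> block_kernel {1..n} {1..n} (connection_laplacian E w \<sigma>).
       fun_inner {1..n} (fun_diff {1..n} \<alpha> \<beta>) f = 0)"
proof -
  interpret connected_connection_graph n E w \<sigma> by fact
  \<comment> \<open>Any single feasible flow has a real cost, which bounds the infimum; finiteness
    thus follows from feasibility, and only solvability of the linear system remains.\<close>
  have "transport_cost n E w \<sigma> \<alpha> \<beta> < \<infinity>" if "feasible_flows n E \<sigma> \<alpha> \<beta> \<noteq> {}"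
    using that unfolding transport_cost_def INF_less_iff by fastforce
  then have "(feasible_flows n E \<sigma> \<alpha> \<beta> \<noteq> {} \<and> transport_cost n E w \<sigma> \<alpha> \<beta> < \<infinity>) \<longleftrightarrow>
      (\<exists>J\<in>fun_space (oriented_edges E).
        block_apply {1..n} (oriented_edges E) (incidence_matrix \<sigma>) J = fun_diff {1..n} \<alpha> \<beta>)"
    by (auto simp: feasible_flows_def)
  also have "\<dots> \<longleftrightarrow>
      (\<forall>f \<in> block_kernel (oriented_edges E) {1..n} (block_transpose (incidence_matrix \<sigma>)).
        fun_inner {1..n} (fun_diff {1..n} \<alpha> \<beta>) f = 0)"
    by (rule block_system_solvable_iff)
      (simp_all add: finite_oriented_edges fun_diff_def fun_space_def)
  also have "block_kernel (oriented_edges E) {1..n} (block_transpose (incidence_matrix \<sigma>)) =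
      block_kernel {1..n} {1..n} (connection_laplacian E w \<sigma>)"
    by (rule block_kernel_connection_laplacian[symmetric])
      (simp_all add: finite_oriented_edges oriented_edge_weight_pos)
  finally show ?thesis .
qed

end
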